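(* For all $\theta\in(0,1)$, finite alphabets $\mathcal{X}$ and $\mathcal{Y}$, $\delta>0$, and $\epsilon\in(0,1)$, $$S_{\delta,\epsilon}(|\mathcal{X}|,|\mathcal{Y}|,\theta)\ \le\ \frac{8\big(\log(5/\epsilon)+|\mathcal{Y}|\log|\mathcal{X}|\big)}{\theta\big((2-e^{-\delta})\log(2-e^{-\delta})+e^{-\delta}-1\big)}.$$
   Context: $\log$ is the natural logarithm. For a joint distribution $P_{XY}$ on finite alphabets, the maximal leakage is $$\mathcal{L}(P_X;P_{Y|X})=\log\sum_{y\in\mathcal{Y}}\max_{x:\,P_X(x)>0}P_{Y|X}(y|x).$$ Let $\mathcal{P}^\theta_{\mathcal{X}\times\mathcal{Y}}$ be the set of probability distributions $P_{XY}$ on $\mathcal{X}\times\mathcal{Y}$ with $\min_{x:\,P_X(x)>0}P_X(x)\ge\theta$. An estimator is a (possibly randomized) function $f:(\mathcal{X}\times\mathcal{Y})^\star\to\mathbb{R}$ on finite sequences. The sample complexity is $$S_{\delta,\epsilon}(|\mathcal{X}|,|\mathcal{Y}|,\theta)=\inf_f\min\Big\{n:\ \Pr\big(|\mathcal{L}(P_X;P_{Y|X})-f(X^n,Y^n)|>\delta\big)<\epsilon\ \text{ for all }P_{XY}\in\mathcal{P}^\theta_{\mathcal{X}\times\mathcal{Y}}\Big\},$$ where $(X_1,Y_1),\dots,(X_n,Y_n)$ are i.i.d. from $P_{XY}$. *)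

theory Defs
  imports "HOL-Probability.Probability"
begin

definition maximal_leakage :: "('a::finite \<times> 'b::finite) pmf \<Rightarrow> real" where
  "maximal_leakage P =
     ln (\<Sum>y\<in>UNIV. MAX x\<in>{x. pmf (map_pmf fst P) x > 0}.
           cond_prob (measure_pmf P) (\<lambda>z. snd z = y) (\<lambda>z. fst z = x))"

definition dists_min_mass :: "real \<Rightarrow> ('a::finite \<times> 'b::finite) pmf set" where
  "dists_min_mass \<theta> =
     {P. (MIN x\<in>{x. pmf (map_pmf fst P) x > 0}. pmf (map_pmf fst P) x) \<ge> \<theta>}"

text \<open>
  A randomized estimator is a Markov kernel: it assigns to each finite sample sequence the law
  of its real-valued output. A deterministic estimator is the special case of Dirac measures.
\<close>

definition estimators :: "(('a \<times> 'b) list \<Rightarrow> real measure) set" where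
  "estimators = measurable (count_space UNIV) (prob_algebra borel)"

definition estimate_law ::
    "(('a \<times> 'b) list \<Rightarrow> real measure) \<Rightarrow> nat \<Rightarrow> ('a \<times> 'b) pmf \<Rightarrow> real measure" where
  "estimate_law f n P = measure_pmf (replicate_pmf n P) \<bind> f"

definition succeeds_with ::
    "real \<Rightarrow> real \<Rightarrow> real \<Rightarrow> (('a::finite \<times> 'b::finite) list \<Rightarrow> real measure) \<Rightarrow> nat \<Rightarrow> bool" where
  "succeeds_with \<delta> \<epsilon> \<theta> f n \<longleftrightarrow>
     (\<forall>P\<in>dists_min_mass \<theta>.
        measure (estimate_law f n P) {t. \<bar>maximal_leakage P - t\<bar> > \<delta>} < \<epsilon>)"

text \<open>
  The alphabets are the finite types \<open>'a\<close> and \<open>'b\<close>. The inner infimum over \<open>enat\<close> is a minimum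
  when some sample size succeeds, and \<open>\<infinity>\<close> otherwise.
\<close>

definition sample_complexity ::
    "real \<Rightarrow> real \<Rightarrow> 'a::finite itself \<Rightarrow> 'b::finite itself \<Rightarrow> real \<Rightarrow> enat" where
  "sample_complexity \<delta> \<epsilon> _ _ \<theta> =
     (INF f\<in>(estimators :: (('a \<times> 'b) list \<Rightarrow> real measure) set).
        INF n\<in>{n. succeeds_with \<delta> \<epsilon> \<theta> f n}. enat n)"

end

theory Submission
  imports Defs
begin

text \<open>
  The estimator is the plug-in one, \<open>ln (\<Sum>y. MAX x. N(x,y) / N(x))\<close>, where \<open>N\<close> counts
  occurrences in the sample. A sum of maxima is the maximum, over the \<open>|X|^|Y|\<close> selections
  \<open>\<phi> : Y \<rightarrow> X\<close>, of the linear functional \<open>\<Sum>y. r (\<phi> y) y\<close>. Conditionally on the \<open>X\<close>-sample, the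
  empirical value of such a functional is a sum of independent variables in \<open>[0, 1 / N(x)]\<close>, so on
  the event that every \<open>N(x) \<ge> m = n \<theta> / 2\<close> it satisfies a Chernoff bound of rate \<open>m\<close>. With
  \<open>u = 1 - e^{-\<delta>}\<close>, an overestimate forces some selection to exceed its bound by a factor
  \<open>1 + u \<le> e^\<delta>\<close> (union bound over all selections), while an underestimate forces the single optimal
  selection to fall short by a factor \<open>1 - u\<close>. These two events and the event that some \<open>N(x)\<close> is
  too small each have probability at most \<open>\<epsilon> / 5\<close>.
\<close>

text \<open>
  Both ratios below take the junk value \<open>0 / 0 = 0\<close> at symbols \<open>x\<close> outside the support; since they are
  nonnegative, maxima over the support agree with maxima over the whole type.
\<close>

definition cond_mass :: "('a::finite \<times> 'b::finite) pmf \<Rightarrow> 'a \<Rightarrow> 'b \<Rightarrow> real" where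
  "cond_mass P x y = pmf P (x, y) / pmf (map_pmf fst P) x"

definition cond_freq :: "('a \<times> 'b) list \<Rightarrow> 'a \<Rightarrow> 'b \<Rightarrow> real" where
  "cond_freq zs x y = real (count_list zs (x, y)) / real (count_list (map fst zs) x)"

section \<open>Selections, conditional masses and the leakage\<close>

definition sum_max :: "('a::finite \<Rightarrow> 'b::finite \<Rightarrow> real) \<Rightarrow> real" where
  "sum_max r = (\<Sum>y\<in>UNIV. MAX x. r x y)"

lemma sum_le_sum_max: "(\<Sum>y\<in>UNIV. r (\<phi> y) y) \<le> sum_max r"
  unfolding sum_max_def by (intro sum_mono Max_ge) auto

lemma sum_max_attained:
  fixes r :: "'a::finite \<Rightarrow> 'b::finite \<Rightarrow> real"
  obtains \<phi> where "sum_max r = (\<Sum>y\<in>UNIV. r (\<phi> y) y)"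
proof -
  have "\<exists>x. (MAX x. r x y) = r x y" for y
  proof -
    have "(MAX x. r x y) \<in> range (\<lambda>x. r x y)" by (rule Max_in) auto
    then show ?thesis by blast
  qed
  then obtain \<phi> where "\<And>y. (MAX x. r x y) = r (\<phi> y) y" by metis
  then have "sum_max r = (\<Sum>y\<in>UNIV. r (\<phi> y) y)" by (simp add: sum_max_def)
  then show thesis by (rule that)
qed

lemma pmf_map_fst:
  fixes P :: "('a::finite \<times> 'b::finite) pmf"
  shows "pmf (map_pmf fst P) x = (\<Sum>y\<in>UNIV. pmf P (x, y))"
proof -
  have "pmf (map_pmf fst P) x = measure_pmf.prob P (fst -` {x})" by (simp add: pmf_map)
  also have "fst -` {x} = Pair x ` (UNIV :: 'b set)" by auto
  also have "measure_pmf.prob P \<dots> = (\<Sum>z\<in>Pair x ` UNIV. pmf P z)"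
    by (rule measure_measure_pmf_finite) simp
  also have "\<dots> = (\<Sum>y\<in>UNIV. pmf P (x, y))" by (subst sum.reindex) (auto simp: inj_on_def)
  finally show ?thesis .
qed

lemma cond_mass_nonneg: "cond_mass P x y \<ge> 0"
  by (simp add: cond_mass_def)

lemma sum_cond_mass:
  assumes "pmf (map_pmf fst P) x > 0"
  shows "(\<Sum>y\<in>UNIV. cond_mass P x y) = 1"
  using assms by (simp add: cond_mass_def pmf_map_fst sum_divide_distrib[symmetric])

lemma pmf_eq_cond_mass: "pmf P (x, y) = pmf (map_pmf fst P) x * cond_mass P x y"
proof (cases "pmf (map_pmf fst P) x = 0")
  case True
  then have "(\<Sum>y\<in>UNIV. pmf P (x, y)) = 0" by (simp only: pmf_map_fst)
  then have "pmf P (x, y) = 0" by (subst (asm) sum_nonneg_eq_0_iff) auto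
  with True show ?thesis by simp
qed (simp add: cond_mass_def)

lemma ex_pmf_pos: "\<exists>x. pmf p x > 0"
  by (meson all_not_in_conv pmf_positive_iff set_pmf_not_empty)

text \<open>A constant selection at a support symbol already has value 1. The bound keeps the
  arguments of \<open>ln\<close> positive and later lets the factor \<open>M\<close> be dropped from
  the Chernoff exponents.\<close>

lemma one_le_sum_max_cond_mass: "1 \<le> sum_max (cond_mass P)"
proof -
  obtain x where "pmf (map_pmf fst P) x > 0" using ex_pmf_pos[of "map_pmf fst P"] ..
  from sum_cond_mass[OF this] sum_le_sum_max[of "cond_mass P" "\<lambda>_. x"] show ?thesis by simp
qed

lemma maximal_leakage_eq:
  fixes P :: "('a::finite \<times> 'b::finite) pmf"
  shows "maximal_leakage P = ln (sum_max (cond_mass P))"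
proof -
  have cp: "cond_prob (measure_pmf P) (\<lambda>z. snd z = y) (\<lambda>z. fst z = x) = cond_mass P x y" for x y
  proof -
    have "{z. snd z = y \<and> fst z = x} = {(x, y)}" by auto
    moreover have "fst -` {x} = {z :: 'a \<times> 'b. fst z = x}" by auto
    ultimately show ?thesis
      by (simp add: cond_prob_def cond_mass_def pmf_map measure_pmf_single)
  qed
  have "(MAX x\<in>{x. pmf (map_pmf fst P) x > 0}. cond_mass P x y) = (MAX x. cond_mass P x y)" for y
  proof (rule antisym)
    let ?A = "{x. pmf (map_pmf fst P) x > 0}"
    obtain x0 where x0: "pmf (map_pmf fst P) x0 > 0" using ex_pmf_pos[of "map_pmf fst P"] ..
    show "(MAX x\<in>?A. cond_mass P x y) \<le> (MAX x. cond_mass P x y)"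
      by (rule Max_mono) (use x0 in auto)
    show "(MAX x. cond_mass P x y) \<le> (MAX x\<in>?A. cond_mass P x y)"
    proof (rule Max.boundedI)
      fix v assume "v \<in> range (\<lambda>x. cond_mass P x y)"
      then obtain x where v: "v = cond_mass P x y" by auto
      show "v \<le> (MAX x\<in>?A. cond_mass P x y)"
      proof (cases "x \<in> ?A")
        case True
        then show ?thesis unfolding v by (intro Max_ge) auto
      next
        case False
        then have "v = 0"
          by (simp add: v cond_mass_def order_less_le)
        have "v \<le> cond_mass P x0 y" by (simp add: \<open>v = 0\<close> cond_mass_nonneg)
        also have "\<dots> \<le> (MAX x\<in>?A. cond_mass P x y)" using x0 by (intro Max_ge) auto
        finally show ?thesis .
      qed
    qed (use x0 in auto)
  qed
  then show ?thesis by (simp add: maximal_leakage_def sum_max_def cp)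
qed

section \<open>Expectations over i.i.d. samples\<close>

lemma finite_set_replicate_pmf:
  fixes P :: "'a::finite pmf"
  shows "finite (set_pmf (replicate_pmf n P))"
  by (rule finite_subset[OF _ finite_lists_length_eq[of UNIV n]]) (auto simp: set_replicate_pmf)

lemma expectation_replicate_Suc:
  fixes P :: "'a::finite pmf" and h :: "'a list \<Rightarrow> real"
  shows "measure_pmf.expectation (replicate_pmf (Suc n) P) h =
    (\<Sum>z\<in>UNIV. pmf P z * measure_pmf.expectation (replicate_pmf n P) (\<lambda>zs. h (z # zs)))"
  unfolding replicate_pmf.simps
  by (subst pmf_expectation_bind[of UNIV])
     (auto simp: map_pmf_def[symmetric] finite_set_replicate_pmf)

lemma expectation_replicate_prod:
  fixes P :: "'a::finite pmf" and g :: "'a \<Rightarrow> real"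
  shows "measure_pmf.expectation (replicate_pmf n P) (\<lambda>zs. prod_list (map g zs)) =
    (\<Sum>z\<in>UNIV. pmf P z * g z) ^ n"
proof (induction n)
  case (Suc n)
  then show ?case unfolding expectation_replicate_Suc
    by (simp add: sum_distrib_right mult_ac)
qed simp

text \<open>Conditioning on the X-sample without conditional measures: inserting the indicator of
  \<open>map fst zs = xs\<close> leaves an unnormalised expectation that still factorises over
  positions. Since \<open>xs\<close> is fixed, \<open>g\<close> may depend on it, as the weights
  \<open>1 / N(x)\<close> of the empirical frequencies require.\<close>

lemma expectation_replicate_prod_fst:
  fixes P :: "('a::finite \<times> 'b::finite) pmf" and g :: "'a \<times> 'b \<Rightarrow> real"
  shows "measure_pmf.expectation (replicate_pmf (length xs) P)
      (\<lambda>zs. if map fst zs = xs then prod_list (map g zs) else 0) =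
    prod_list (map (\<lambda>x. \<Sum>y\<in>UNIV. pmf P (x, y) * g (x, y)) xs)"
proof (induction xs)
  case (Cons x xs)
  let ?E = "measure_pmf.expectation (replicate_pmf (length xs) P)
      (\<lambda>zs. if map fst zs = xs then prod_list (map g zs) else 0)"
  have *: "measure_pmf.expectation (replicate_pmf (length xs) P)
      (\<lambda>zs. if map fst (z # zs) = x # xs then prod_list (map g (z # zs)) else 0) =
      (if fst z = x then g z * ?E else 0)" for z
    by (auto simp flip: integral_mult_right_zero intro!: Bochner_Integration.integral_cong)
  have "measure_pmf.expectation (replicate_pmf (length (x # xs)) P)
      (\<lambda>zs. if map fst zs = x # xs then prod_list (map g zs) else 0) =
      (\<Sum>z\<in>UNIV. if fst z = x then pmf P z * g z * ?E else 0)"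
    unfolding length_Cons expectation_replicate_Suc * by (intro sum.cong) auto
  also have "\<dots> = (\<Sum>z\<in>Pair x ` UNIV. pmf P z * g z * ?E)"
    by (rule sum.mono_neutral_cong_right) auto
  also have "\<dots> = (\<Sum>y\<in>UNIV. pmf P (x, y) * g (x, y) * ?E)"
    by (subst sum.reindex) (auto simp: inj_on_def)
  also have "\<dots> = (\<Sum>y\<in>UNIV. pmf P (x, y) * g (x, y)) * ?E"
    by (simp add: sum_distrib_right)
  finally show ?case by (simp add: Cons.IH)
qed simp

lemma expectation_replicate_split_fst:
  fixes P :: "('a::finite \<times> 'b::finite) pmf" and F :: "('a \<times> 'b) list \<Rightarrow> real"
  shows "measure_pmf.expectation (replicate_pmf n P) F =
    (\<Sum>xs | length xs = n. measure_pmf.expectation (replicate_pmf n P)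
       (\<lambda>zs. if map fst zs = xs then F zs else 0))"
proof -
  have fin: "finite {xs :: 'a list. length xs = n}"
    using finite_lists_length_eq[of "UNIV :: 'a set" n] by simp
  have "measure_pmf.expectation (replicate_pmf n P) F = measure_pmf.expectation (replicate_pmf n P)
       (\<lambda>zs. \<Sum>xs | length xs = n. if map fst zs = xs then F zs else 0)"
    \<comment> \<open>Samples almost surely have length \<open>n\<close>, so exactly one
      \<open>xs\<close> contributes to the sum.\<close>
    by (intro integral_cong_AE) (auto simp: AE_measure_pmf_iff set_replicate_pmf fin)
  also have "\<dots> = (\<Sum>xs | length xs = n. measure_pmf.expectation (replicate_pmf n P)
       (\<lambda>zs. if map fst zs = xs then F zs else 0))"
    by (intro Bochner_Integration.integral_sum integrable_measure_pmf_finite finite_set_replicate_pmf)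
  finally show ?thesis .
qed

lemma prob_le_expectation:
  fixes g :: "'a \<Rightarrow> real"
  assumes "finite (set_pmf p)" "\<And>z. z \<in> A \<Longrightarrow> 1 \<le> g z" "\<And>z. 0 \<le> g z"
  shows "measure_pmf.prob p A \<le> measure_pmf.expectation p g"
proof -
  have "measure_pmf.prob p A = measure_pmf.expectation p (indicator A)" by simp
  also have "\<dots> \<le> measure_pmf.expectation p g"
    using assms by (intro integral_mono integrable_measure_pmf_finite) (auto split: split_indicator)
  finally show ?thesis .
qed

section \<open>Chernoff bound for a fixed selection\<close>

text \<open>A sample point \<open>z\<close> matters only for the index \<open>y = snd z\<close>, and
  only if it lies on the graph of the selection. Regrouping by sample points turns the exponential
  of the sum into a product over positions.\<close>

lemma sum_count_list_graph:
  fixes v :: "'a \<Rightarrow> real" and \<phi> :: "'b::finite \<Rightarrow> 'a"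
  shows "(\<Sum>y\<in>UNIV. real (count_list zs (\<phi> y, y)) * v (\<phi> y)) =
    (\<Sum>z\<leftarrow>zs. if \<phi> (snd z) = fst z then v (fst z) else 0)"
proof (induction zs)
  case (Cons z zs)
  have "(\<Sum>y\<in>UNIV. real (count_list (z # zs) (\<phi> y, y)) * v (\<phi> y)) =
      (\<Sum>y\<in>UNIV. real (count_list zs (\<phi> y, y)) * v (\<phi> y) +
        (if y = snd z then if \<phi> (snd z) = fst z then v (fst z) else 0 else 0))"
    by (intro sum.cong) (auto simp: algebra_simps prod_eq_iff)
  then show ?case by (simp add: sum.distrib Cons.IH)
qed simp

text \<open>Convexity of \<open>exp\<close> between \<open>0\<close> and \<open>s\<close>, with
  weight \<open>m / N\<close>. Spreading the tilt \<open>m * s\<close> over \<open>N\<close>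
  observations thus costs no more than spreading it over only \<open>m\<close>, for either sign of
  \<open>s\<close>.\<close>

lemma exp_scale_le:
  fixes s m N :: real
  assumes "0 < m" "m \<le> N"
  shows "N * (exp (m * s / N) - 1) \<le> m * (exp s - 1)"
proof -
  have N: "N > 0" using assms by linarith
  have "exp ((1 - m / N) *\<^sub>R 0 + (m / N) *\<^sub>R s) \<le> (1 - m / N) * exp 0 + (m / N) * exp s"
    using assms N by (intro convex_onD[OF exp_convex]) auto
  then have "N * (exp (m * s / N) - 1) \<le> N * ((m / N) * (exp s - 1))"
    using N by (intro mult_left_mono) (auto simp: algebra_simps)
  then show ?thesis using N by simp
qed

text \<open>Symbols outside the support almost surely never occur, so a positive lower bound on
  counts can only be asked on the support.\<close>

definition ample :: "real \<Rightarrow> ('a::finite \<times> 'b::finite) pmf \<Rightarrow> 'a list \<Rightarrow> bool" where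
  "ample m P xs \<longleftrightarrow> (\<forall>x. pmf (map_pmf fst P) x > 0 \<longrightarrow> m \<le> real (count_list xs x))"

lemma exp_sum_list: "exp (\<Sum>z\<leftarrow>zs. f z) = (\<Prod>z\<leftarrow>zs. exp (f z :: real))"
  by (induction zs) (auto simp: exp_add)

lemma prod_list_map_mono:
  fixes f g :: "'a \<Rightarrow> real"
  assumes "\<And>x. 0 \<le> f x" "\<And>x. f x \<le> g x"
  shows "(\<Prod>x\<leftarrow>xs. f x) \<le> (\<Prod>x\<leftarrow>xs. g x)"
proof (induction xs)
  case (Cons x xs)
  then show ?case
    using assms by (auto intro!: mult_mono prod_list_nonneg intro: order_trans)
qed simp

lemma prod_list_mult_exp:
  fixes p r :: "'a::finite \<Rightarrow> real"
  shows "(\<Prod>x\<leftarrow>xs. p x * exp (r x)) =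
    (\<Prod>x\<leftarrow>xs. p x) * exp (\<Sum>x\<in>UNIV. real (count_list xs x) * r x)"
proof -
  have "(\<Prod>x\<leftarrow>xs. p x * exp (r x)) = (\<Prod>x\<leftarrow>xs. p x) * exp (\<Sum>x\<leftarrow>xs. r x)"
    by (induction xs) (auto simp: exp_add)
  also have "(\<Sum>x\<leftarrow>xs. r x) = (\<Sum>x\<in>UNIV. real (count_list xs x) * r x)"
  proof (induction xs)
    case (Cons a xs)
    have "(\<Sum>x\<in>UNIV. real (count_list (a # xs) x) * r x) =
        (\<Sum>x\<in>UNIV. real (count_list xs x) * r x + (if x = a then r a else 0))"
      by (intro sum.cong) (auto simp: algebra_simps)
    then show ?case by (simp add: sum.distrib Cons.IH)
  qed simp
  finally show ?thesis .
qed

lemma sum_prod_list_pmf_fst: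
  fixes P :: "('a::finite \<times> 'b::finite) pmf"
  shows "(\<Sum>xs | length xs = n. \<Prod>x\<leftarrow>xs. pmf (map_pmf fst P) x) = 1"
proof -
  have "(\<Sum>xs | length xs = n. \<Prod>x\<leftarrow>xs. pmf (map_pmf fst P) x) =
      (\<Sum>xs | length xs = n. measure_pmf.expectation (replicate_pmf n P)
       (\<lambda>zs. if map fst zs = xs then 1 else 0))"
  proof (intro sum.cong refl)
    fix xs :: "'a list" assume xs: "xs \<in> {xs. length xs = n}"
    then show "(\<Prod>x\<leftarrow>xs. pmf (map_pmf fst P) x) = measure_pmf.expectation (replicate_pmf n P)
       (\<lambda>zs. if map fst zs = xs then 1 else 0)"
      using expectation_replicate_prod_fst[of xs P "\<lambda>_. 1"]
      by (simp add: pmf_map_fst map_replicate_const cong: if_cong)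
  qed
  also have "\<dots> = measure_pmf.expectation (replicate_pmf n P) (\<lambda>_. 1)"
    by (rule expectation_replicate_split_fst[symmetric])
  finally show ?thesis by simp
qed

text \<open>At a position with symbol \<open>x\<close> the factor is \<open>exp (w x)\<close> with
  conditional probability \<open>Q x\<close> and 1 otherwise, so its mean is at most
  \<open>exp (Q x * (exp (w x) - 1))\<close>. Multiplying over the \<open>N(x)\<close> positions and
  applying \<open>exp_scale_le\<close> replaces \<open>N(x)\<close> by \<open>m\<close>. The result
  is the moment generating function of a Poisson variable whose mean is \<open>m\<close> times the
  true value of the selection.\<close>

lemma expectation_exp_sum_cond_freq_fst_le:
  fixes P :: "('a::finite \<times> 'b::finite) pmf" and \<phi> :: "'b \<Rightarrow> 'a"
  assumes m: "m > 0" and ample: "ample m P xs"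
  shows "measure_pmf.expectation (replicate_pmf (length xs) P)
      (\<lambda>zs. if map fst zs = xs then exp (m * s * (\<Sum>y\<in>UNIV. cond_freq zs (\<phi> y) y)) else 0)
    \<le> (\<Prod>x\<leftarrow>xs. pmf (map_pmf fst P) x) *
      exp (m * (\<Sum>y\<in>UNIV. cond_mass P (\<phi> y) y) * (exp s - 1))"
proof -
  \<comment> \<open>The tilt \<open>m * s\<close> of a conditional frequency, shared among the
    observations of \<open>x\<close>.\<close>
  define w where "w x = m * s / real (count_list xs x)" for x
  define g where "g z = exp (if \<phi> (snd z) = fst z then w (fst z) else 0)" for z
  \<comment> \<open>On the support, \<open>Q x\<close> is the conditional probability given
    \<open>x\<close> that the selection, applied to the observed second coordinate, returns
    \<open>x\<close>.\<close>
  define Q where "Q x = (\<Sum>y\<in>UNIV. if \<phi> y = x then cond_mass P x y else 0)" for x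
  have Q0: "Q x \<ge> 0" for x
    unfolding Q_def by (intro sum_nonneg) (auto simp: cond_mass_nonneg)
  have "measure_pmf.expectation (replicate_pmf (length xs) P)
      (\<lambda>zs. if map fst zs = xs then exp (m * s * (\<Sum>y\<in>UNIV. cond_freq zs (\<phi> y) y)) else 0)
    = measure_pmf.expectation (replicate_pmf (length xs) P)
      (\<lambda>zs. if map fst zs = xs then prod_list (map g zs) else 0)"
  proof (intro Bochner_Integration.integral_cong refl)
    fix zs
    have "exp (m * s * (\<Sum>y\<in>UNIV. cond_freq zs (\<phi> y) y)) = prod_list (map g zs)"
      if "map fst zs = xs"
    proof -
      have "m * s * (\<Sum>y\<in>UNIV. cond_freq zs (\<phi> y) y) =
          (\<Sum>y\<in>UNIV. real (count_list zs (\<phi> y, y)) * w (\<phi> y))"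
        by (simp add: cond_freq_def w_def that sum_distrib_left mult_ac)
      then show ?thesis
        by (simp add: sum_count_list_graph exp_sum_list g_def[abs_def])
    qed
    then show "(if map fst zs = xs then exp (m * s * (\<Sum>y\<in>UNIV. cond_freq zs (\<phi> y) y)) else 0)
        = (if map fst zs = xs then prod_list (map g zs) else 0)" by simp
  qed
  also have "\<dots> = (\<Prod>x\<leftarrow>xs. \<Sum>y\<in>UNIV. pmf P (x, y) * g (x, y))"
    by (rule expectation_replicate_prod_fst)
  also have "\<dots> \<le> (\<Prod>x\<leftarrow>xs. pmf (map_pmf fst P) x * exp (Q x * (exp (w x) - 1)))"
  proof (rule prod_list_map_mono)
    fix x
    show "0 \<le> (\<Sum>y\<in>UNIV. pmf P (x, y) * g (x, y))"
      by (intro sum_nonneg) (auto simp: g_def)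
    have "(\<Sum>y\<in>UNIV. pmf P (x, y) * g (x, y)) =
        pmf (map_pmf fst P) x * (\<Sum>y\<in>UNIV. cond_mass P x y * g (x, y))"
      by (simp add: pmf_eq_cond_mass[of P x] sum_distrib_left mult_ac)
    also have "\<dots> \<le> pmf (map_pmf fst P) x * exp (Q x * (exp (w x) - 1))"
    proof (cases "pmf (map_pmf fst P) x > 0")
      case True
      have "(\<Sum>y\<in>UNIV. cond_mass P x y * g (x, y)) =
          (\<Sum>y\<in>UNIV. cond_mass P x y + (if \<phi> y = x then cond_mass P x y else 0) * (exp (w x) - 1))"
        by (intro sum.cong) (auto simp: g_def algebra_simps)
      also have "\<dots> = 1 + Q x * (exp (w x) - 1)"
        by (simp add: sum.distrib sum_cond_mass[OF True] Q_def sum_distrib_right)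
      also have "\<dots> \<le> exp (Q x * (exp (w x) - 1))" by (rule exp_ge_add_one_self)
      finally show ?thesis by (intro mult_left_mono) auto
    next
      case False
      then have "pmf (map_pmf fst P) x = 0" by (simp add: order_less_le)
      then show ?thesis by simp
    qed
    finally show "(\<Sum>y\<in>UNIV. pmf P (x, y) * g (x, y)) \<le>
      pmf (map_pmf fst P) x * exp (Q x * (exp (w x) - 1))" .
  qed
  also have "\<dots> = (\<Prod>x\<leftarrow>xs. pmf (map_pmf fst P) x) *
      exp (\<Sum>x\<in>UNIV. real (count_list xs x) * (Q x * (exp (w x) - 1)))"
    by (rule prod_list_mult_exp)
  also have "\<dots> \<le> (\<Prod>x\<leftarrow>xs. pmf (map_pmf fst P) x) * exp (\<Sum>x\<in>UNIV. m * Q x * (exp s - 1))"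
  proof (intro mult_left_mono)
    show "exp (\<Sum>x\<in>UNIV. real (count_list xs x) * (Q x * (exp (w x) - 1)))
        \<le> exp (\<Sum>x\<in>UNIV. m * Q x * (exp s - 1))"
      unfolding exp_le_cancel_iff
    proof (rule sum_mono)
      fix x
      show "real (count_list xs x) * (Q x * (exp (w x) - 1)) \<le> m * Q x * (exp s - 1)"
      proof (cases "pmf (map_pmf fst P) x > 0")
        case True
        then have "real (count_list xs x) * (exp (w x) - 1) \<le> m * (exp s - 1)"
          unfolding w_def using ample m by (intro exp_scale_le) (auto simp: ample_def)
        from mult_left_mono[OF this Q0[of x]] show ?thesis by (simp add: mult_ac)
      next
        case False
        then have "pmf (map_pmf fst P) x = 0" by (simp add: order_less_le)
        \<comment> \<open>Off the support \<open>cond_mass\<close> divides by zero and is therefore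
          0.\<close>
        then have "Q x = 0" by (simp add: Q_def cond_mass_def cong: if_cong)
        then show ?thesis by simp
      qed
    qed
    show "0 \<le> (\<Prod>x\<leftarrow>xs. pmf (map_pmf fst P) x)"
      by (rule prod_list_nonneg) auto
  qed
  also have "(\<Sum>x\<in>UNIV. m * Q x * (exp s - 1)) = m * (\<Sum>x\<in>UNIV. Q x) * (exp s - 1)"
    by (simp add: sum_distrib_left sum_distrib_right)
  also have "(\<Sum>x\<in>UNIV. Q x) = (\<Sum>y\<in>UNIV. cond_mass P (\<phi> y) y)"
    unfolding Q_def by (subst sum.swap) simp
  finally show ?thesis .
qed

text \<open>Keeping the factor \<open>s\<close> on both sides of the event covers the upper tail
  (\<open>s > 0\<close>) and the lower tail (\<open>s < 0\<close>) at once. The conditional bound is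
  uniform over ample X-samples, so averaging it with the law of the X-sample preserves it.\<close>

lemma chernoff_sum_cond_freq:
  fixes P :: "('a::finite \<times> 'b::finite) pmf" and \<phi> :: "'b \<Rightarrow> 'a"
  assumes m: "m > 0"
  shows "measure_pmf.prob (replicate_pmf n P)
      {zs. ample m P (map fst zs) \<and> s * t \<le> s * (\<Sum>y\<in>UNIV. cond_freq zs (\<phi> y) y)}
    \<le> exp (m * ((\<Sum>y\<in>UNIV. cond_mass P (\<phi> y) y) * (exp s - 1) - s * t))"
proof -
  define S where "S zs = (\<Sum>y\<in>UNIV. cond_freq zs (\<phi> y) y)" for zs
  define C where "C = exp (m * (\<Sum>y\<in>UNIV. cond_mass P (\<phi> y) y) * (exp s - 1))"
  define F where "F zs = (if ample m P (map fst zs) then exp (m * s * S zs) else 0)" for zs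
  have "measure_pmf.prob (replicate_pmf n P) {zs. ample m P (map fst zs) \<and> s * t \<le> s * S zs}
      \<le> measure_pmf.expectation (replicate_pmf n P) (\<lambda>zs. exp (- (m * s * t)) * F zs)"
  proof (rule prob_le_expectation[OF finite_set_replicate_pmf])
    fix zs assume zs: "zs \<in> {zs. ample m P (map fst zs) \<and> s * t \<le> s * S zs}"
    then have "m * (s * t) \<le> m * (s * S zs)" using m by (simp add: mult_le_cancel_left_pos)
    then have "1 \<le> exp (m * (s * S zs) - m * (s * t))" unfolding one_le_exp_iff by linarith
    also have "\<dots> = exp (- (m * s * t)) * F zs"
      using zs by (simp add: F_def exp_diff exp_minus divide_inverse mult_ac)
    finally show "1 \<le> exp (- (m * s * t)) * F zs" .
  qed (simp add: F_def)
  also have "\<dots> = exp (- (m * s * t)) * measure_pmf.expectation (replicate_pmf n P) F"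
    by simp
  also have "measure_pmf.expectation (replicate_pmf n P) F =
    (\<Sum>xs | length xs = n. measure_pmf.expectation (replicate_pmf n P)
       (\<lambda>zs. if map fst zs = xs then F zs else 0))"
    by (rule expectation_replicate_split_fst)
  also have "\<dots> \<le> (\<Sum>xs | length xs = n. (\<Prod>x\<leftarrow>xs. pmf (map_pmf fst P) x) * C)"
  proof (rule sum_mono)
    fix xs :: "'a list" assume "xs \<in> {xs. length xs = n}"
    then have n: "n = length xs" by simp
    show "measure_pmf.expectation (replicate_pmf n P) (\<lambda>zs. if map fst zs = xs then F zs else 0)
        \<le> (\<Prod>x\<leftarrow>xs. pmf (map_pmf fst P) x) * C"
    proof (cases "ample m P xs")
      case True
      have "(\<lambda>zs. if map fst zs = xs then F zs else 0) =
          (\<lambda>zs. if map fst zs = xs then exp (m * s * S zs) else 0)"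
        using True by (auto simp: F_def fun_eq_iff)
      then show ?thesis
        unfolding n C_def S_def
        using expectation_exp_sum_cond_freq_fst_le[OF m True, of s \<phi>] by simp
    next
      case False
      have "(\<lambda>zs. if map fst zs = xs then F zs else 0) = (\<lambda>_. 0)"
        using False by (auto simp: F_def fun_eq_iff)
      moreover have "0 \<le> (\<Prod>x\<leftarrow>xs. pmf (map_pmf fst P) x)"
        by (rule prod_list_nonneg) auto
      ultimately show ?thesis by (simp add: C_def)
    qed
  qed
  also have "\<dots> = C"
    by (simp add: sum_distrib_right[symmetric] sum_prod_list_pmf_fst)
  finally show ?thesis
    by (simp add: S_def C_def exp_add[symmetric] algebra_simps)
qed

section \<open>Lower tail of the symbol counts\<close>

lemma prob_count_list_lt_half_le:
  fixes P :: "('a::finite \<times> 'b::finite) pmf"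
  assumes "\<theta> \<le> pmf (map_pmf fst P) x" "0 \<le> \<theta>"
  shows "measure_pmf.prob (replicate_pmf n P)
      {zs. real (count_list (map fst zs) x) < real n * \<theta> / 2}
    \<le> exp (- (real n * \<theta> / 7))"
proof -
  define p where "p = pmf (map_pmf fst P) x"
  \<comment> \<open>Each occurrence of \<open>x\<close> contributes a factor 1/2, so the product is
    \<open>2\<close> to the power minus the count: a Chernoff tilt of \<open>- ln 2\<close>.\<close>
  define g :: "'a \<times> 'b \<Rightarrow> real" where "g z = (if fst z = x then 1 / 2 else 1)" for z
  have prod: "prod_list (map g zs) = exp (- (ln 2 * real (count_list (map fst zs) x)))" for zs
  proof (induction zs)
    case (Cons z zs)
    then show ?case by (simp add: g_def exp_diff exp_minus distrib_left exp_add field_simps)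
  qed simp
  have p: "(\<Sum>z\<in>UNIV. pmf P z * g z) = 1 - p / 2"
  proof -
    have "(\<Sum>z\<in>UNIV. pmf P z * g z) =
        (\<Sum>z\<in>UNIV. pmf P z - (if fst z = x then pmf P z / 2 else 0))"
      by (intro sum.cong) (auto simp: g_def)
    also have "\<dots> = (\<Sum>z\<in>UNIV. pmf P z) - (\<Sum>z\<in>UNIV. if fst z = x then pmf P z / 2 else 0)"
      by (rule sum_subtractf)
    also have "(\<Sum>z\<in>UNIV. if fst z = x then pmf P z / 2 else 0) =
        (\<Sum>z\<in>Pair x ` UNIV. pmf P z / 2)"
      by (rule sum.mono_neutral_cong_right) auto
    also have "\<dots> = p / 2"
      by (subst sum.reindex) (auto simp: inj_on_def p_def pmf_map_fst sum_divide_distrib)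
    finally show ?thesis by (simp add: sum_pmf_eq_1)
  qed
  have "p \<le> 1" by (simp add: p_def pmf_le_1)
  have "measure_pmf.prob (replicate_pmf n P) {zs. real (count_list (map fst zs) x) < real n * \<theta> / 2}
      \<le> measure_pmf.expectation (replicate_pmf n P)
          (\<lambda>zs. exp (ln 2 * (real n * \<theta> / 2)) * prod_list (map g zs))"
    by (rule prob_le_expectation[OF finite_set_replicate_pmf])
       (auto simp: prod exp_add[symmetric] mult_le_cancel_left_pos simp flip: right_diff_distrib)
  also have "\<dots> = exp (ln 2 * (real n * \<theta> / 2)) * (1 - p / 2) ^ n"
    by (simp add: expectation_replicate_prod p)
  also have "\<dots> \<le> exp (ln 2 * (real n * \<theta> / 2)) * exp (- (\<theta> / 2)) ^ n"
  proof (intro mult_left_mono power_mono)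
    show "1 - p / 2 \<le> exp (- (\<theta> / 2))"
      using exp_ge_add_one_self[of "- (\<theta> / 2)"] assms by (simp add: p_def)
  qed (use \<open>p \<le> 1\<close> in auto)
  also have "\<dots> = exp (- ((1 - ln 2) / 2 * (real n * \<theta>)))"
    by (simp add: exp_of_nat_mult[symmetric] exp_add[symmetric] field_simps)
  also have "\<dots> \<le> exp (- (real n * \<theta> / 7))"
  proof -
    \<comment> \<open>From \<open>ln 2 \<le> 25/36\<close> the rate is at least 11/72, which exceeds
      1/7.\<close>
    have "(1 / 7) * (real n * \<theta>) \<le> (1 - ln 2) / 2 * (real n * \<theta>)"
      using ln2_le_25_over_36 assms by (intro mult_right_mono) auto
    then show ?thesis by simp
  qed
  finally show ?thesis .
qed

section \<open>The plug-in estimator as a Dirac kernel\<close>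

definition plug_in_estimator :: "('a::finite \<times> 'b::finite) list \<Rightarrow> real measure" where
  "plug_in_estimator zs = return borel (ln (sum_max (cond_freq zs)))"

lemma plug_in_estimator_in_estimators: "plug_in_estimator \<in> estimators"
proof -
  have "plug_in_estimator zs \<in> space (prob_algebra borel)" for zs :: "('a::finite \<times> 'b::finite) list"
    by (simp add: plug_in_estimator_def space_prob_algebra prob_space_return)
  then show ?thesis by (simp add: estimators_def)
qed

lemma measure_estimate_law_plug_in:
  "measure (estimate_law plug_in_estimator n P) {t. \<bar>l - t\<bar> > \<delta>} =
    measure_pmf.prob (replicate_pmf n P) {zs. \<bar>l - ln (sum_max (cond_freq zs))\<bar> > \<delta>}"
proof -
  have "estimate_law plug_in_estimator n P =
      distr (measure_pmf (replicate_pmf n P)) borel (\<lambda>zs. ln (sum_max (cond_freq zs)))"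
    unfolding estimate_law_def plug_in_estimator_def by (rule bind_return_distr') auto
  moreover have "{t. \<bar>l - t\<bar> > \<delta>} \<in> sets borel" by measurable
  ultimately show ?thesis by (simp add: measure_distr vimage_def)
qed

section \<open>Elementary inequalities for the rate\<close>

text \<open>Positivity is the strict form of \<open>ln z \<le> z - 1\<close> at
  \<open>z = 1 / (1 + u)\<close>; the upper bound is \<open>ln (1 + u) \<le> u\<close>. The upper
  bound lets the rate of the upper tail also serve for the lower tail and for the counts.\<close>

lemma rate_bounds:
  fixes u :: real
  assumes "0 < u" "u < 1"
  shows "0 < (1 + u) * ln (1 + u) - u" "(1 + u) * ln (1 + u) - u \<le> u\<^sup>2"
proof -
  have "ln (1 / (1 + u)) < 1 / (1 + u) - 1"
    using ln_le_minus_one[of "1 / (1 + u)"] ln_eq_minus_one[of "1 / (1 + u)"] assms by fastforce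
  then show "0 < (1 + u) * ln (1 + u) - u"
    using assms by (simp add: ln_div field_simps)
  have "(1 + u) * ln (1 + u) \<le> (1 + u) * u"
    using assms ln_add_one_self_le_self[of u] by (intro mult_left_mono) auto
  then show "(1 + u) * ln (1 + u) - u \<le> u\<^sup>2"
    by (simp add: power2_eq_square algebra_simps)
qed

text \<open>The product of the quadratics for \<open>-u\<close> and \<open>u\<close> is
  \<open>1 + u^4 / 4\<close>, and the second one is a lower bound for \<open>exp u\<close>.\<close>

lemma exp_minus_le_quadratic:
  fixes u :: real
  assumes "0 \<le> u"
  shows "exp (- u) \<le> 1 - u + u\<^sup>2 / 2"
proof -
  have pos: "0 < 1 - u + u\<^sup>2 / 2"
    using zero_le_power2[of "u - 1"] unfolding power2_diff by simp
  have "1 \<le> (1 - u + u\<^sup>2 / 2) * (1 + u + u\<^sup>2 / 2)"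
    using zero_le_power[OF assms, of 4] by (simp add: eval_nat_numeral algebra_simps)
  also have "\<dots> \<le> (1 - u + u\<^sup>2 / 2) * exp u"
    using pos exp_lower_Taylor_quadratic[OF assms] by (intro mult_left_mono) auto
  finally show ?thesis by (simp add: exp_minus field_simps)
qed

section \<open>Failure events and the union bound\<close>

lemma plug_in_failure_cases:
  fixes zs :: "('a::finite \<times> 'b::finite) list"
  assumes m: "0 < m" and \<delta>: "0 < \<delta>" and u: "u = 1 - exp (- \<delta>)"
    and M: "M = sum_max (cond_mass P)" "M = (\<Sum>y\<in>UNIV. cond_mass P (\<psi> y) y)"
    and fail: "\<bar>maximal_leakage P - ln (sum_max (cond_freq zs))\<bar> > \<delta>"
    and ample: "ample m P (map fst zs)"
  shows "(\<exists>\<phi>. (1 + u) * M \<le> (\<Sum>y\<in>UNIV. cond_freq zs (\<phi> y) y)) \<or>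
    (\<Sum>y\<in>UNIV. cond_freq zs (\<psi> y) y) \<le> (1 - u) * M"
proof (rule ccontr)
  assume "\<not> ?thesis"
  then have up: "(\<Sum>y\<in>UNIV. cond_freq zs (\<phi> y) y) < (1 + u) * M"
    and lo: "(1 - u) * M < (\<Sum>y\<in>UNIV. cond_freq zs (\<psi> y) y)" for \<phi>
    by (auto simp: not_le)
  have M1: "1 \<le> M" using one_le_sum_max_cond_mass[of P] M by simp
  \<comment> \<open>Besides giving the lower estimate, this makes the empirical sum positive, so
    that \<open>ln\<close> is strictly monotone there.\<close>
  have lo': "exp (- \<delta>) * M < sum_max (cond_freq zs)"
    using lo sum_le_sum_max[of "cond_freq zs" \<psi>] u by simp
  moreover have "0 < exp (- \<delta>) * M" using M1 by simp
  ultimately have pos: "0 < sum_max (cond_freq zs)" by linarith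
  obtain \<phi> where "sum_max (cond_freq zs) = (\<Sum>y\<in>UNIV. cond_freq zs (\<phi> y) y)"
    by (rule sum_max_attained)
  then have "sum_max (cond_freq zs) < (1 + u) * M" using up by simp
  \<comment> \<open>This is \<open>cosh \<delta> \<ge> 1\<close>, whereas
    \<open>1 - u = exp (- \<delta>)\<close> is exact.\<close>
  also have "1 + u \<le> exp \<delta>"
  proof -
    have "2 * 1 \<le> exp \<delta> + exp (- \<delta>)"
      using cosh_real_ge_1[of \<delta>] by (simp add: cosh_def)
    then show ?thesis by (simp add: u)
  qed
  finally have up': "sum_max (cond_freq zs) < exp \<delta> * M" using M1 by simp
  have "ln (sum_max (cond_freq zs)) < ln (exp \<delta> * M)"
    using up' pos M1 by (subst ln_less_cancel_iff) auto
  moreover have "ln (exp (- \<delta>) * M) < ln (sum_max (cond_freq zs))"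
    using lo' pos M1 by (subst ln_less_cancel_iff) auto
  ultimately show False
    using fail M1 by (simp add: maximal_leakage_eq M(1)[symmetric] ln_mult abs_if split: if_splits)
qed

text \<open>Each failure event is bounded through \<open>exp (- c)\<close>. The constant 7 is
  dictated by the counts: their exponent is \<open>2 * m / 7\<close>, and
  \<open>m \<ge> m * h \<ge> 7 / 2 * c\<close>. The tails have exponents at least
  \<open>m * h\<close> and \<open>m * h / 2\<close>, which leaves slack.\<close>

lemma succeeds_with_plug_in:
  fixes \<theta> \<delta> \<epsilon> :: real
  assumes \<theta>: "0 < \<theta>" and \<delta>: "0 < \<delta>" and \<epsilon>: "0 < \<epsilon>" "\<epsilon> < 1"
    and u: "u = 1 - exp (- \<delta>)"
    and h: "h = (1 + u) * ln (1 + u) - u"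
    and c: "c = ln (5 / \<epsilon>) + real CARD('b) * ln (real CARD('a))"
    and n: "7 * c \<le> real n * \<theta> * h"
  shows "succeeds_with \<delta> \<epsilon> \<theta> (plug_in_estimator :: ('a::finite \<times> 'b::finite) list \<Rightarrow> _) n"
  unfolding succeeds_with_def
proof
  fix P :: "('a \<times> 'b) pmf" assume "P \<in> dists_min_mass \<theta>"
  then have \<theta>_le: "\<theta> \<le> pmf (map_pmf fst P) x" if "pmf (map_pmf fst P) x > 0" for x
    using that unfolding dists_min_mass_def by (auto intro: order_trans[OF _ Min_le])
  let ?pr = "measure_pmf.prob (replicate_pmf n P)"
  define m where "m = real n * \<theta> / 2"
  define M where "M = sum_max (cond_mass P)"
  obtain \<psi> where \<psi>: "M = (\<Sum>y\<in>UNIV. cond_mass P (\<psi> y) y)"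
    unfolding M_def by (rule sum_max_attained)
  have M1: "1 \<le> M" unfolding M_def by (rule one_le_sum_max_cond_mass)
  have u01: "0 < u" "u < 1" using \<delta> by (auto simp: u)
  have h0: "0 < h" and hu: "h \<le> u\<^sup>2" using rate_bounds[OF u01] by (auto simp: h)
  have "u\<^sup>2 \<le> 1" using u01 by (simp add: power_le_one)
  have card: "1 \<le> real CARD('a)" "1 \<le> CARD('b)" by (simp_all add: Suc_le_eq)
  have c0: "0 < c" using \<epsilon> card by (auto simp: c intro!: add_pos_nonneg mult_nonneg_nonneg)
  have m0: "0 < m"
    using n c0 h0 \<theta> by (smt (verit) m_def half_gt_zero mult_pos_pos of_nat_0_le_iff zero_less_mult_iff)
  have mh: "7 / 2 * c \<le> m * h" using n by (simp add: m_def field_simps)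
  have mhM: "m * h \<le> m * M * h" using M1 m0 h0 by simp
  \<comment> \<open>The term \<open>|Y| ln |X|\<close> in \<open>c\<close> pays for the union over
    all selections and leaves \<open>\<epsilon> / 5\<close>.\<close>
  have "real CARD('a) ^ CARD('b) = exp (real CARD('b) * ln (real CARD('a)))"
    using card by (simp add: exp_of_nat_mult)
  then have "exp (- c) * real CARD('a) ^ CARD('b) = exp (- ln (5 / \<epsilon>))"
    by (simp only: exp_add[symmetric] c) simp
  also have "\<dots> = \<epsilon> / 5" using \<epsilon> by (simp add: exp_minus)
  finally have ec: "exp (- c) * real CARD('a) ^ CARD('b) = \<epsilon> / 5" .

  define few where "few x = {zs :: ('a \<times> 'b) list. real (count_list (map fst zs) x) < m}" for x
  define high where "high \<phi> = {zs. ample m P (map fst zs) \<and>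
    ln (1 + u) * ((1 + u) * M) \<le> ln (1 + u) * (\<Sum>y\<in>UNIV. cond_freq zs (\<phi> y) y)}" for \<phi> :: "'b \<Rightarrow> 'a"
  define low where "low = {zs. ample m P (map fst zs) \<and>
    - u * ((1 - u) * M) \<le> - u * (\<Sum>y\<in>UNIV. cond_freq zs (\<psi> y) y)}"
  define supp where "supp = {x. pmf (map_pmf fst P) x > 0}"
  have few: "?pr (few x) \<le> exp (- c)" if "x \<in> supp" for x
  proof -
    have "?pr (few x) \<le> exp (- (real n * \<theta> / 7))"
      unfolding few_def m_def using that \<theta> \<theta>_le
      by (intro prob_count_list_lt_half_le) (auto simp: supp_def)
    also have "m * h \<le> m * 1" using m0 hu \<open>u\<^sup>2 \<le> 1\<close> by (intro mult_left_mono) auto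
    then have "exp (- (real n * \<theta> / 7)) \<le> exp (- c)" using mh by (simp add: m_def)
    finally show ?thesis .
  qed
  have high: "?pr (high \<phi>) \<le> exp (- c)" for \<phi>
  proof -
    \<comment> \<open>The tilt \<open>ln (1 + u)\<close> is optimal for mean \<open>M\<close> and
      threshold \<open>(1 + u) * M\<close>, and yields the rate \<open>h\<close>. A selection of
      smaller mean only does better.\<close>
    have "?pr (high \<phi>) \<le> exp (m * ((\<Sum>y\<in>UNIV. cond_mass P (\<phi> y) y) * (exp (ln (1 + u)) - 1)
        - ln (1 + u) * ((1 + u) * M)))"
      unfolding high_def by (rule chernoff_sum_cond_freq[OF m0])
    also have "\<dots> \<le> exp (m * (M * u - ln (1 + u) * ((1 + u) * M)))"
      using m0 u01 sum_le_sum_max[of "cond_mass P" \<phi>]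
      by (auto simp: M_def intro!: mult_left_mono mult_right_mono)
    also have "m * (M * u - ln (1 + u) * ((1 + u) * M)) = - (m * M * h)"
      by (simp add: h algebra_simps)
    also have "exp (- (m * M * h)) \<le> exp (- c)" using mh mhM c0 by simp
    finally show ?thesis .
  qed
  have low: "?pr low \<le> exp (- c)"
  proof -
    \<comment> \<open>The tilt \<open>-u\<close> replaces the optimal \<open>ln (1 - u)\<close>: the
      quadratic bound on \<open>exp (- u)\<close> then gives the exponent \<open>- u^2 / 2\<close>,
      hence at most \<open>- h / 2\<close>.\<close>
    have "?pr low \<le> exp (m * (M * (exp (- u) - 1) - (- u) * ((1 - u) * M)))"
      unfolding low_def
      by (subst (2) \<psi>) (rule chernoff_sum_cond_freq[OF m0])
    also have "m * (M * (exp (- u) - 1) - (- u) * ((1 - u) * M)) =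
        m * M * (exp (- u) - 1 + u - u\<^sup>2)"
      by (simp add: algebra_simps power2_eq_square)
    also have "m * M * (exp (- u) - 1 + u - u\<^sup>2) \<le> m * M * (- (h / 2))"
      using m0 M1 hu u01 exp_minus_le_quadratic[of u] by (intro mult_left_mono) auto
    also have "\<dots> \<le> - c" using mh mhM c0 by simp
    finally show ?thesis by simp
  qed
  have "?pr {zs. \<bar>maximal_leakage P - ln (sum_max (cond_freq zs))\<bar> > \<delta>}
      \<le> ?pr ((\<Union>x\<in>supp. few x) \<union> ((\<Union>\<phi>. high \<phi>) \<union> low))"
  proof (intro measure_pmf.finite_measure_mono subsetI)
    fix zs :: "('a \<times> 'b) list"
    assume "zs \<in> {zs. \<bar>maximal_leakage P - ln (sum_max (cond_freq zs))\<bar> > \<delta>}"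
    then have fail: "\<bar>maximal_leakage P - ln (sum_max (cond_freq zs))\<bar> > \<delta>" by simp
    show "zs \<in> (\<Union>x\<in>supp. few x) \<union> ((\<Union>\<phi>. high \<phi>) \<union> low)"
    proof (cases "ample m P (map fst zs)")
      case True
      from plug_in_failure_cases[OF m0 \<delta> u M_def \<psi> fail True] show ?thesis
        using True u01 by (auto simp: high_def low_def)
    next
      case False
      then show ?thesis by (auto simp: ample_def supp_def few_def)
    qed
  qed simp
  also have "\<dots> \<le> ?pr (\<Union>x\<in>supp. few x) + (?pr (\<Union>\<phi>. high \<phi>) + ?pr low)"
    by (intro order_trans[OF measure_Un_le] add_left_mono measure_Un_le) auto
  also have "\<dots> \<le> \<epsilon> / 5 + (\<epsilon> / 5 + \<epsilon> / 5)"
  proof (intro add_mono)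
    have "?pr (\<Union>x\<in>supp. few x) \<le> (\<Sum>x\<in>supp. ?pr (few x))"
      by (rule measure_UNION_le) auto
    also have "\<dots> \<le> real (card supp) * exp (- c)"
      using few by (rule sum_bounded_above)
    also have "\<dots> \<le> real CARD('a) * exp (- c)"
      by (intro mult_right_mono) (auto intro!: card_mono)
    \<comment> \<open>As \<open>'b\<close> is nonempty, there are at least as many selections as
      symbols, so the same \<open>c\<close> covers this union.\<close>
    also have "\<dots> \<le> real CARD('a) ^ CARD('b) * exp (- c)"
      using card by (intro mult_right_mono self_le_power) auto
    finally show "?pr (\<Union>x\<in>supp. few x) \<le> \<epsilon> / 5" using ec by (simp add: mult.commute)
    have "?pr (\<Union>\<phi>. high \<phi>) \<le> (\<Sum>\<phi>\<in>UNIV. ?pr (high \<phi>))"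
      by (rule measure_UNION_le) auto
    also have "\<dots> \<le> real CARD('b \<Rightarrow> 'a) * exp (- c)"
      using high by (rule sum_bounded_above)
    finally show "?pr (\<Union>\<phi>. high \<phi>) \<le> \<epsilon> / 5"
      using ec by (simp add: card_fun mult.commute)
    have "exp (- c) * 1 \<le> exp (- c) * real CARD('a) ^ CARD('b)"
      using card by (intro mult_left_mono one_le_power) auto
    with low ec show "?pr low \<le> \<epsilon> / 5" by linarith
  qed
  also have "\<dots> < \<epsilon>" using \<epsilon> by simp
  finally show "measure (estimate_law plug_in_estimator n P) {t. \<delta> < \<bar>maximal_leakage P - t\<bar>} < \<epsilon>"
    by (simp add: measure_estimate_law_plug_in)
qed

section \<open>Choice of the sample size\<close>

theorem theorem11:
  fixes \<theta> \<delta> \<epsilon> :: real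
  assumes "0 < \<theta>" and "\<theta> < 1"
    and "\<delta> > 0"
    and "0 < \<epsilon>" and "\<epsilon> < 1"
  shows "ereal_of_enat (sample_complexity \<delta> \<epsilon> TYPE('a::finite) TYPE('b::finite) \<theta>) \<le>
    ereal (8 * (ln (5 / \<epsilon>) + real CARD('b) * ln (real CARD('a))) /
      (\<theta> * ((2 - exp (- \<delta>)) * ln (2 - exp (- \<delta>)) + exp (- \<delta>) - 1)))"
proof -
  define u where "u = 1 - exp (- \<delta>)"
  define h where "h = (1 + u) * ln (1 + u) - u"
  define c where "c = ln (5 / \<epsilon>) + real CARD('b) * ln (real CARD('a))"
  define B where "B = 8 * c / (\<theta> * h)"
  \<comment> \<open>Rounding down keeps \<open>n\<close> below the claimed bound. It loses less than
    \<open>\<theta> * h \<le> 1 \<le> c\<close>, which is why the constant is 8 where 7 suffices for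
    success.\<close>
  define n where "n = nat \<lfloor>B\<rfloor>"
  have u01: "0 < u" "u < 1" using assms by (auto simp: u_def)
  have h0: "0 < h" and hu: "h \<le> u\<^sup>2" using rate_bounds[OF u01] by (auto simp: h_def)
  have "u\<^sup>2 \<le> 1" using u01 by (simp add: power_le_one)
  \<comment> \<open>Here \<open>5 / \<epsilon> \<ge> 5\<close>, which is larger than
    \<open>exp 1\<close>.\<close>
  have "1 \<le> ln (5 / \<epsilon>)"
  proof (subst ln_ge_iff)
    have "5 / 1 \<le> 5 / \<epsilon>" using assms by (intro divide_left_mono) auto
    then show "exp 1 \<le> 5 / \<epsilon>" using exp_le by linarith
  qed (use assms in simp)
  moreover have "0 \<le> real CARD('b) * ln (real CARD('a))"
    by (intro mult_nonneg_nonneg) (auto simp: Suc_le_eq)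
  ultimately have c1: "1 \<le> c" unfolding c_def by linarith
  have B0: "0 \<le> B" using assms h0 c1 by (simp add: B_def)
  have "B < real n + 1" unfolding n_def using B0 by linarith
  then have "8 * c < (real n + 1) * (\<theta> * h)"
    using assms h0 by (simp add: B_def pos_divide_less_eq)
  moreover have "\<theta> * h \<le> 1 * 1"
    using assms h0 hu \<open>u\<^sup>2 \<le> 1\<close> by (intro mult_mono) auto
  ultimately have "7 * c \<le> real n * \<theta> * h" using c1 by (simp add: algebra_simps)
  then have succ: "succeeds_with \<delta> \<epsilon> \<theta> (plug_in_estimator :: ('a \<times> 'b) list \<Rightarrow> _) n"
    using assms by (intro succeeds_with_plug_in[OF _ _ _ _ u_def h_def c_def])
  have "sample_complexity \<delta> \<epsilon> TYPE('a) TYPE('b) \<theta> \<le> enat n"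
    unfolding sample_complexity_def
    by (rule INF_lower2[OF plug_in_estimator_in_estimators], rule INF_lower) (use succ in simp)
  then have "ereal_of_enat (sample_complexity \<delta> \<epsilon> TYPE('a) TYPE('b) \<theta>) \<le> ereal_of_enat (enat n)"
    by (simp only: ereal_of_enat_le_iff)
  also have "\<dots> \<le> ereal B" using B0 by (simp add: n_def)
  also have "B = 8 * (ln (5 / \<epsilon>) + real CARD('b) * ln (real CARD('a))) /
      (\<theta> * ((2 - exp (- \<delta>)) * ln (2 - exp (- \<delta>)) + exp (- \<delta>) - 1))"
    by (simp add: B_def h_def c_def u_def algebra_simps)
  finally show ?thesis .
qed

end
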